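(* No efficient mechanism is strongly contribution incentive-compatible when $m\ge 4$ and $n\ge 3$. That is: for every finite set $A$ of $m\ge 4$ projects and every finite set $N$ of $n\ge 3$ agents, there exist budgets $B_i>0$ and normalized utility functions $u_i\colon A\to\mathbb R_{\ge0}$ ($i\in N$) such that no mechanism is both efficient and strongly contribution incentive-compatible.
   Context: For $V\ge 0$, $\Delta(V)$ is the set of functions $\delta\colon A\to\mathbb R_{\ge0}$ with $\sum_{x\in A}\delta(x)=V$. Each agent $i\in N$ has a budget $B_i>0$ and a utility function $u_i\colon A\to\mathbb R_{\ge0}$, not identically zero and normalized so that $\min\{u_i(x)\colon x\in A, u_i(x)>0\}=1$; $u_i(\delta)=\sum_{x\in A}\delta(x)u_i(x)$, and $u_i^{\max}=\max_{y\in A}u_i(y)$. A (contribution) profile is $C=(C_i)_{i\in N}$ with $C_i\in[0,B_i]$; $|C|=\sum_{i\in N}C_i$. Utilities and budgets being fixed, a mechanism $f$ maps every profile $C$ to a distribution $f(C)\in\Delta(|C|)$. $(C_{-i},C_i')$ denotes the profile obtained from $C$ by replacing agent $i$'s contribution by $C_i'$. Given a profile $C$, $\delta'\in\Delta(|C|)$ dominates $\delta\in\Delta(|C|)$ if $u_i(\delta')\ge u_i(\delta)$ for all $i\in N$ with $C_i>0$ and $u_i(\delta')>u_i(\delta)$ for some $i\in N$ with $C_i>0$. A mechanism $f$ is efficient if for every profile $C$ no distribution in $\Delta(|C|)$ dominates $f(C)$. A mechanism $f$ is strongly contribution incentive-compatible if for every $i\in N$, $u_i(f(C))-C_i\,u_i^{\max}$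 is weakly increasing in $C_i$, i.e. for all profiles $C$ and all $C_i'$ with $0\le C_i'\le C_i$: $u_i(f(C_{-i},C_i'))-C_i'u_i^{\max}\le u_i(f(C_{-i},C_i))-C_iu_i^{\max}$. *)

theory Defs
  imports Complex_Main "HOL-Library.FuncSet"
begin

text \<open>
  Projects form a finite set \<open>A\<close> and agents a finite set \<open>N\<close>.  Distributions and profiles are
  extensional functions, so that each is determined by its values on \<open>A\<close> and \<open>N\<close>, respectively,
  and a mechanism cannot depend on junk values outside \<open>N\<close>.
\<close>

definition distributions :: "'a set \<Rightarrow> real \<Rightarrow> ('a \<Rightarrow> real) set" where
  "distributions A V = {\<delta> \<in> A \<rightarrow>\<^sub>E {0..}. (\<Sum>x\<in>A. \<delta> x) = V}"

definition profiles :: "'i set \<Rightarrow> ('i \<Rightarrow> real) \<Rightarrow> ('i \<Rightarrow> real) set" where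
  "profiles N B = (\<Pi>\<^sub>E i\<in>N. {0..B i})"

definition total :: "'i set \<Rightarrow> ('i \<Rightarrow> real) \<Rightarrow> real" where
  "total N C = (\<Sum>i\<in>N. C i)"

definition normalized_utility :: "'a set \<Rightarrow> ('a \<Rightarrow> real) \<Rightarrow> bool" where
  "normalized_utility A v \<longleftrightarrow>
     (\<forall>x\<in>A. v x \<ge> 0) \<and> (\<exists>x\<in>A. v x \<noteq> 0) \<and> Min {v x | x. x \<in> A \<and> v x > 0} = 1"

definition utility :: "'a set \<Rightarrow> ('a \<Rightarrow> real) \<Rightarrow> ('a \<Rightarrow> real) \<Rightarrow> real" where
  "utility A v \<delta> = (\<Sum>x\<in>A. \<delta> x * v x)"

definition max_utility :: "'a set \<Rightarrow> ('a \<Rightarrow> real) \<Rightarrow> real" where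
  "max_utility A v = Max (v ` A)"

definition mechanism ::
  "'a set \<Rightarrow> 'i set \<Rightarrow> ('i \<Rightarrow> real) \<Rightarrow> (('i \<Rightarrow> real) \<Rightarrow> 'a \<Rightarrow> real) \<Rightarrow> bool" where
  "mechanism A N B f \<longleftrightarrow> (\<forall>C \<in> profiles N B. f C \<in> distributions A (total N C))"

definition dominates ::
  "'a set \<Rightarrow> 'i set \<Rightarrow> ('i \<Rightarrow> 'a \<Rightarrow> real) \<Rightarrow> ('i \<Rightarrow> real) \<Rightarrow> ('a \<Rightarrow> real) \<Rightarrow> ('a \<Rightarrow> real) \<Rightarrow> bool" where
  "dominates A N u C \<delta>' \<delta> \<longleftrightarrow>
     (\<forall>i\<in>N. C i > 0 \<longrightarrow> utility A (u i) \<delta>' \<ge> utility A (u i) \<delta>) \<and>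
     (\<exists>i\<in>N. C i > 0 \<and> utility A (u i) \<delta>' > utility A (u i) \<delta>)"

definition efficient ::
  "'a set \<Rightarrow> 'i set \<Rightarrow> ('i \<Rightarrow> real) \<Rightarrow> ('i \<Rightarrow> 'a \<Rightarrow> real) \<Rightarrow> (('i \<Rightarrow> real) \<Rightarrow> 'a \<Rightarrow> real) \<Rightarrow> bool" where
  "efficient A N B u f \<longleftrightarrow>
     (\<forall>C \<in> profiles N B. \<not> (\<exists>\<delta>' \<in> distributions A (total N C). dominates A N u C \<delta>' (f C)))"

definition strongly_contribution_incentive_compatible ::
  "'a set \<Rightarrow> 'i set \<Rightarrow> ('i \<Rightarrow> real) \<Rightarrow> ('i \<Rightarrow> 'a \<Rightarrow> real) \<Rightarrow> (('i \<Rightarrow> real) \<Rightarrow> 'a \<Rightarrow> real) \<Rightarrow> bool" where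
  "strongly_contribution_incentive_compatible A N B u f \<longleftrightarrow>
     (\<forall>i\<in>N. \<forall>C \<in> profiles N B. \<forall>c. 0 \<le> c \<and> c \<le> C i \<longrightarrow>
        utility A (u i) (f (C(i := c))) - c * max_utility A (u i)
          \<le> utility A (u i) (f C) - C i * max_utility A (u i))"

end

theory Submission
  imports Defs
begin

text \<open>
  Three agents have pairwise different favourite projects, each worth \<open>r = 5/3\<close> to one of them and
  nothing to the others, and there is a compromise project \<open>d\<close> worth \<open>1\<close> to everybody.  If two of
  the agents contribute \<open>1\<close> each, incentive compatibility gives both of them utility at least \<open>r\<close>.
  Since \<open>r < 2\<close>, efficiency forbids funding both favourites, so the agent whose favourite is not
  funded gets everything from \<open>d\<close>, which thus receives at least \<open>r\<close>; the third agent gets at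
  least \<open>r\<close> without contributing.  When she contributes \<open>1\<close> as well, incentive compatibility gives
  her at least \<open>2 * r\<close>.  By symmetry all three have at least \<open>2 * r\<close>, a sum of at least
  \<open>6 * r = 10\<close>, whereas three units of money generate a total utility of at most \<open>3 * 3\<close>.
\<close>

text \<open>Here \<open>p i\<close> is the favourite of agent \<open>i\<close>. Agents outside
  \<open>T\<close> also need a normalized utility, so \<open>d\<close> is the only project they
  value.\<close>

definition compromise_utility :: "'i set \<Rightarrow> ('i \<Rightarrow> 'a) \<Rightarrow> 'a \<Rightarrow> 'i \<Rightarrow> 'a \<Rightarrow> real" where
  "compromise_utility T p d i x = (if x = d then 1 else if i \<in> T \<and> x = p i then 5 / 3 else 0)"

definition unit_profile :: "'i set \<Rightarrow> 'i set \<Rightarrow> 'i \<Rightarrow> real" where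
  "unit_profile N S = (\<lambda>i\<in>N. if i \<in> S then 1 else 0)"

lemma unit_profile_in_profiles: "unit_profile N S \<in> profiles N (\<lambda>_. 1)"
  by (auto simp: unit_profile_def profiles_def)

lemma total_unit_profile:
  assumes "finite N" "S \<subseteq> N"
  shows "total N (unit_profile N S) = card S"
proof -
  have "total N (unit_profile N S) = (\<Sum>i\<in>N. if i \<in> S then 1 else 0)"
    unfolding total_def unit_profile_def by (intro sum.cong) auto
  also have "\<dots> = card S"
    using assms by (simp add: sum.If_cases Int_absorb1)
  finally show ?thesis .
qed

lemma unit_profile_remove:
  assumes "i \<in> N"
  shows "(unit_profile N S)(i := 0) = unit_profile N (S - {i})"
  using assms by (auto simp: unit_profile_def)

locale compromise =
  fixes A :: "'a set" and N T :: "'i set" and p :: "'i \<Rightarrow> 'a" and d :: 'a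
  assumes finite_A: "finite A" and finite_N: "finite N"
    and T_subset: "T \<subseteq> N" and card_T: "card T = 3"
    and p_inj: "inj_on p T" and p_in: "p ` T \<subseteq> A - {d}" and d_in: "d \<in> A"
begin

abbreviation "u \<equiv> compromise_utility T p d"

lemma normalized_compromise_utility: "normalized_utility A (u i)"
proof -
  have "{u i x | x. x \<in> A \<and> u i x > 0} = (if i \<in> T then {1, 5 / 3} else {1})"
    using p_in d_in by (auto simp: compromise_utility_def split: if_splits)
  then show ?thesis
    using d_in by (auto simp: normalized_utility_def compromise_utility_def)
qed

lemma max_compromise_utility:
  assumes "i \<in> T"
  shows "max_utility A (u i) = 5 / 3"
  unfolding max_utility_def using assms finite_A p_in
  by (intro Max_eqI) (auto simp: compromise_utility_def image_iff intro!: bexI[of _ "p i"])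

lemma utility_compromise:
  assumes "i \<in> T"
  shows "utility A (u i) \<delta> = \<delta> d + 5 / 3 * \<delta> (p i)"
proof -
  have pi: "p i \<in> A" "p i \<noteq> d" using assms p_in by auto
  have "utility A (u i) \<delta> = (\<Sum>x\<in>{d, p i}. \<delta> x * u i x)"
    unfolding utility_def using finite_A d_in pi assms
    by (intro sum.mono_neutral_right) (auto simp: compromise_utility_def)
  then show ?thesis using pi assms by (simp add: compromise_utility_def)
qed

lemma favourites_bound:
  assumes "\<delta> \<in> distributions A V"
  shows "\<delta> d + (\<Sum>i\<in>T. \<delta> (p i)) \<le> V"
proof -
  have "finite T" using card_T card.infinite by fastforce
  have "\<delta> d + (\<Sum>i\<in>T. \<delta> (p i)) = (\<Sum>x\<in>insert d (p ` T). \<delta> x)"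
    using p_in \<open>finite T\<close> by (subst sum.insert) (auto simp: sum.reindex[OF p_inj])
  also have "\<dots> \<le> (\<Sum>x\<in>A. \<delta> x)"
    using assms p_in d_in finite_A by (intro sum_mono2) (auto simp: distributions_def)
  finally show ?thesis using assms by (simp add: distributions_def)
qed

text \<open>If both favourites were funded, moving equal amounts from them to \<open>d\<close> would
  make both contributors better off: for each unit taken from either favourite, a contributor loses
  \<open>5 / 3\<close> and gains \<open>2\<close>.\<close>

lemma efficient_pair:
  assumes "efficient A N (\<lambda>_. 1) u f" and "mechanism A N (\<lambda>_. 1) f"
    and ij: "i \<in> T" "j \<in> T" "i \<noteq> j"
  shows "f (unit_profile N {i, j}) (p i) = 0 \<or> f (unit_profile N {i, j}) (p j) = 0"
proof (rule ccontr)
  let ?C = "unit_profile N {i, j}"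
  define \<delta> where "\<delta> = f ?C"
  \<comment> \<open>The minimum is the largest equal amount that can be taken from both favourites
    while keeping them nonnegative.\<close>
  define m where "m = min (\<delta> (p i)) (\<delta> (p j))"
  define \<delta>' where "\<delta>' = \<delta>(p i := \<delta> (p i) - m, p j := \<delta> (p j) - m, d := \<delta> d + 2 * m)"
  assume "\<not> ?thesis"
  then have nz: "\<delta> (p i) \<noteq> 0" "\<delta> (p j) \<noteq> 0" by (auto simp: \<delta>_def)
  have \<delta>: "\<delta> \<in> distributions A (total N ?C)"
    using assms(2) unit_profile_in_profiles unfolding mechanism_def \<delta>_def by blast
  have p: "p i \<in> A" "p j \<in> A" "p i \<noteq> d" "p j \<noteq> d" "p i \<noteq> p j"
    using ij p_in p_inj by (auto dest: inj_onD)
  have nonneg: "\<delta> x \<ge> 0" if "x \<in> A" for x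
    using \<delta> that by (auto simp: distributions_def)
  have m: "m > 0" "m \<le> \<delta> (p i)" "m \<le> \<delta> (p j)"
    using nonneg[OF p(1)] nonneg[OF p(2)] nz by (auto simp: m_def)
  \<comment> \<open>Only three projects change, by \<open>-m\<close>, \<open>-m\<close> and
    \<open>2 * m\<close>, so the total is preserved.\<close>
  have "(\<Sum>x\<in>A. \<delta>' x) - (\<Sum>x\<in>A. \<delta> x) = (\<Sum>x\<in>{p i, p j, d}. \<delta>' x - \<delta> x)"
    unfolding sum_subtractf[symmetric] using finite_A p d_in
    by (intro sum.mono_neutral_right) (auto simp: \<delta>'_def)
  also have "\<dots> = 0" using p by (simp add: \<delta>'_def)
  finally have "\<delta>' \<in> distributions A (total N ?C)"
    using \<delta> nonneg[OF d_in] m p d_in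
    by (auto simp: distributions_def \<delta>'_def PiE_iff extensional_def)
  moreover have "utility A (u k) \<delta>' > utility A (u k) \<delta>" if "k \<in> {i, j}" for k
    using that ij p m by (auto simp: utility_compromise \<delta>'_def field_simps)
  \<comment> \<open>Dominance only looks at agents with a positive contribution, here exactly
    \<open>i\<close> and \<open>j\<close>.\<close>
  then have "dominates A N u ?C \<delta>' \<delta>"
    using ij(1) T_subset
    by (auto simp: dominates_def unit_profile_def less_imp_le intro!: bexI[of _ i])
  ultimately show False
    using assms(1) unit_profile_in_profiles unfolding efficient_def \<delta>_def by blast
qed

text \<open>Incentive compatibility compares contributions \<open>0\<close> and \<open>1\<close>:
  the subtracted term grows by the maximal utility \<open>5 / 3\<close>, so the utility must grow by
  at least as much.\<close>

lemma join_gain: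
  assumes "strongly_contribution_incentive_compatible A N (\<lambda>_. 1) u f"
    and "i \<in> T" "i \<in> S"
  shows "utility A (u i) (f (unit_profile N S))
           \<ge> 5 / 3 + utility A (u i) (f (unit_profile N (S - {i})))"
proof -
  have "i \<in> N" using assms(2) T_subset by auto
  then have "unit_profile N S i = 1" using assms(3) by (simp add: unit_profile_def)
  then show ?thesis
    using assms(1)[unfolded strongly_contribution_incentive_compatible_def, rule_format,
        OF \<open>i \<in> N\<close> unit_profile_in_profiles, of 0 S]
      max_compromise_utility[OF assms(2)] unit_profile_remove[OF \<open>i \<in> N\<close>, of S]
    by simp
qed

lemma mechanism_nonneg:
  assumes "mechanism A N (\<lambda>_. 1) f" "x \<in> A"
  shows "f (unit_profile N S) x \<ge> 0"
  using assms unit_profile_in_profiles[of N S]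
  by (fastforce simp: mechanism_def distributions_def)

text \<open>Joining gives each contributor at least \<open>5 / 3\<close>, and the one whose
  favourite is unfunded can only draw this from \<open>d\<close>.\<close>

lemma pair_compromise:
  assumes mech: "mechanism A N (\<lambda>_. 1) f" and eff: "efficient A N (\<lambda>_. 1) u f"
    and ic: "strongly_contribution_incentive_compatible A N (\<lambda>_. 1) u f"
    and ij: "i \<in> T" "j \<in> T" "i \<noteq> j"
  shows "f (unit_profile N {i, j}) d \<ge> 5 / 3"
proof -
  have "utility A (u k) (f (unit_profile N {i, j})) \<ge> 5 / 3" if "k \<in> {i, j}" for k
  proof -
    have k: "k \<in> T" using that ij by auto
    then have "utility A (u k) (f (unit_profile N ({i, j} - {k}))) \<ge> 0"
      using mechanism_nonneg[OF mech d_in] mechanism_nonneg[OF mech, of "p k"] p_in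
      by (auto simp: utility_compromise intro!: add_nonneg_nonneg)
    with join_gain[OF ic k that] show ?thesis by linarith
  qed
  from this[of i] this[of j] efficient_pair[OF eff mech ij] show ?thesis
    using ij by (auto simp: utility_compromise)
qed

lemma impossibility:
  assumes mech: "mechanism A N (\<lambda>_. 1) f" and eff: "efficient A N (\<lambda>_. 1) u f"
    and ic: "strongly_contribution_incentive_compatible A N (\<lambda>_. 1) u f"
  shows False
proof -
  let ?\<delta> = "f (unit_profile N T)"
  \<comment> \<open>Half of this comes from \<open>d\<close> while the other two contribute alone,
    half from joining them.\<close>
  have gain: "utility A (u k) ?\<delta> \<ge> 10 / 3" if k: "k \<in> T" for k
  proof -
    have "card (T - {k}) = 2" using card_T k by simp
    then obtain i j where ij: "T - {k} = {i, j}" "i \<noteq> j" by (auto simp: card_2_iff)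
    then have "i \<in> T" "j \<in> T" by auto
    then have "f (unit_profile N (T - {k})) d \<ge> 5 / 3"
      using pair_compromise[OF mech eff ic] ij by simp
    moreover have "f (unit_profile N (T - {k})) (p k) \<ge> 0"
      using mechanism_nonneg[OF mech] p_in k by auto
    ultimately show ?thesis
      using join_gain[OF ic k k] by (simp add: utility_compromise[OF k])
  qed
  have "10 = (\<Sum>k\<in>T. 10 / 3 :: real)" using card_T by simp
  also have "\<dots> \<le> (\<Sum>k\<in>T. utility A (u k) ?\<delta>)" by (intro sum_mono gain)
  also have "\<dots> = 3 * ?\<delta> d + 5 / 3 * (\<Sum>k\<in>T. ?\<delta> (p k))"
    using card_T by (simp add: utility_compromise sum.distrib sum_distrib_left)
  \<comment> \<open>Money on a favourite generates less total utility than money on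
    \<open>d\<close>, so it may be counted at the rate of \<open>d\<close>.\<close>
  also have "\<dots> \<le> 3 * (?\<delta> d + (\<Sum>k\<in>T. ?\<delta> (p k)))"
  proof -
    have "(\<Sum>k\<in>T. ?\<delta> (p k)) \<ge> 0"
      using mechanism_nonneg[OF mech] p_in by (intro sum_nonneg) auto
    then show ?thesis by simp
  qed
  also have "\<dots> \<le> 3 * 3"
  proof -
    have "?\<delta> \<in> distributions A (card T)"
      using mech unit_profile_in_profiles[of N T] total_unit_profile[OF finite_N T_subset]
      by (auto simp: mechanism_def)
    from favourites_bound[OF this] show ?thesis using card_T by simp
  qed
  finally show False by simp
qed

end

theorem proposition2:
  fixes A :: "'a set" and N :: "'i set"
  assumes "finite A" and "card A \<ge> 4"
    and "finite N" and "card N \<ge> 3"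
  shows "\<exists>(B :: 'i \<Rightarrow> real) (u :: 'i \<Rightarrow> 'a \<Rightarrow> real).
           (\<forall>i\<in>N. B i > 0) \<and>
           (\<forall>i\<in>N. normalized_utility A (u i)) \<and>
           \<not> (\<exists>f. mechanism A N B f \<and> efficient A N B u f \<and>
                  strongly_contribution_incentive_compatible A N B u f)"
proof -
  obtain T where T: "T \<subseteq> N" "card T = 3" "finite T"
    using obtain_subset_with_card_n[OF assms(4)] by metis
  obtain d where d: "d \<in> A" using assms(2) by fastforce
  \<comment> \<open>Three distinct favourites besides \<open>d\<close> require four
    projects.\<close>
  have "card T \<le> card (A - {d})" using assms(1,2) d T by simp
  then obtain p where p: "p ` T \<subseteq> A - {d}" "inj_on p T"
    using card_le_inj[of T "A - {d}"] T assms(1) by auto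
  interpret compromise A N T p d
    using assms T d p by unfold_locales auto
  show ?thesis
    using normalized_compromise_utility impossibility
    by (intro exI[of _ "\<lambda>_. 1"] exI[of _ "compromise_utility T p d"]) auto
qed

end
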